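(* Consider a naive Bayes classifier with class variable $Y_{Cl}$ and features $Y_{Fe_1},\dots,Y_{Fe_m}$, and let $\operatorname{P}$ be a distribution in the model. Let $V$ be any nonempty set of indices of conditional probability parameters of the feature variables, let $\tilde\theta_V$ be new values for these parameters, and let $\tilde{\operatorname{P}}$ be the $\tilde\theta_V$-proportional covariation of $\operatorname{P}$. Then $\tilde{\operatorname{P}}$ is the I-projection of $\operatorname{P}$ in $L_{\mathrm{sensi}}$, i.e. $\tilde{\operatorname{P}}\in L_{\mathrm{sensi}}$ and $\mathcal D(\tilde{\operatorname{P}}\|\operatorname{P})=\min_{\operatorname{Q}\in L_{\mathrm{sensi}}}\mathcal D(\operatorname{Q}\|\operatorname{P})$.
   Context: Naive Bayes classifier. $Y_{Cl}$ takes values in a finite set $\mathbb Y_{Cl}$ and each feature $Y_{Fe_i}$, $i\in[m]=\{1,\dots,m\}$, takes values in a finite set $\mathbb Y_{Fe_i}$; the features are conditionally independent given the class. The model consists of the distributions on $\mathbb Y=\mathbb Y_{Cl}\times\prod_{i\in[m]}\mathbb Y_{Fe_i}$ of the form $$\operatorname{P}(c,y_1,\dots,y_m)=\theta_c\prod_{i\in[m]}\theta_{i,y_i,c},$$ with strictly positive parameters $\theta_c=\operatorname{P}(Y_{Cl}=c)$ and $\theta_{i,y,c}=\operatorname{P}(Y_{Fe_i}=y\mid Y_{Cl}=c)$ satisfying $\sum_{c}\theta_c=1$ and $\sum_{y\in\mathbb Y_{Fe_i}}\theta_{i,y,c}=1$ for every $i\in[m]$ and $c\in\mathbb Y_{Cl}$.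 For each $(i,c)$ let $S_{i,c}=\{(i,y,c):y\in\mathbb Y_{Fe_i}\}$ be the index set of the parameters of the conditional distribution of $Y_{Fe_i}$ given $Y_{Cl}=c$. Varied parameters. $V$ is a nonempty subset of $\bigcup_{i,c}S_{i,c}$ such that $V_{i,c}=V\cap S_{i,c}$ is a proper subset of $S_{i,c}$ for all $(i,c)$. $\tilde\theta_V$ is a vector of positive numbers such that $|\tilde\theta_{V_{i,c}}|\in(0,1)$ whenever $V_{i,c}\ne\emptyset$, where $|\cdot|$ denotes the sum of the entries of a vector. Proportional covariation. $\tilde{\operatorname{P}}$ is the distribution in the model with parameters $\tilde\theta$ obtained from the parameters $\theta$ of $\operatorname{P}$ as follows: the class probabilities $\theta_c$ and all blocks $S_{i,c}$ with $V_{i,c}=\emptyset$ are unchanged; in each block with $V_{i,c}\neq\emptyset$, the entries indexed by $V_{i,c}$ are set to $\tilde\theta_{V_{i,c}}$ and $\tilde\theta_j=\frac{1-|\tilde\theta_{V_{i,c}}|}{1-|\theta_{V_{i,c}}|}\theta_j$ for $j\in S_{i,c}\setminus V_{i,c}$. $L_{\mathrm{sensi}}$ is the set of distributions in the model whose class probabilities and whose parameters in blocks $S_{i,c}$ with $V_{i,c}=\emptyset$ equal those of $\operatorname{P}$, and whose parameters indexed by $V$ equal $\tilde\theta_V$ (the remaining parameters, those in $S_{i,c}\setminus V_{i,c}$ with $V_{i,c}\ne\emptyset$, are free subject to positivity and the sum-to-one conditions). The I-divergence (Kullback-Leibler divergence) is $\mathcal D(\operatorname{Q}\|\operatorname{P})=\sum_{y\in\mathbb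 Y}\operatorname{Q}(y)\ln\frac{\operatorname{Q}(y)}{\operatorname{P}(y)}$. An I-projection of $\operatorname{P}$ onto a set $L$ of distributions is an element $\operatorname{P}^*\in L$ with $\mathcal D(\operatorname{P}^*\|\operatorname{P})=\min_{\operatorname{Q}\in L}\mathcal D(\operatorname{Q}\|\operatorname{P})$. *)

theory Defs
  imports "HOL-Probability.Probability"
begin

text \<open>
  The class takes values in \<open>C\<close>, and feature \<open>i \<in> {1..m}\<close> takes values in \<open>F i\<close>.
  The feature value sets share one ambient type, which is no restriction for finite sets.
  The index of a conditional probability parameter is a triple \<open>(i, y, c)\<close>.
\<close>

definition nb_space :: "'c set \<Rightarrow> nat \<Rightarrow> (nat \<Rightarrow> 'y set) \<Rightarrow> ('c \<times> (nat \<Rightarrow> 'y)) set" where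
  "nb_space C m F = C \<times> (\<Pi>\<^sub>E i\<in>{1..m}. F i)"

definition block :: "(nat \<Rightarrow> 'y set) \<Rightarrow> nat \<Rightarrow> 'c \<Rightarrow> (nat \<times> 'y \<times> 'c) set" where
  "block F i c = {(i, y, c) | y. y \<in> F i}"

definition nb_params ::
  "'c set \<Rightarrow> nat \<Rightarrow> (nat \<Rightarrow> 'y set) \<Rightarrow> ('c \<Rightarrow> real) \<Rightarrow> (nat \<times> 'y \<times> 'c \<Rightarrow> real) \<Rightarrow> bool" where
  "nb_params C m F \<theta>C \<theta>F \<longleftrightarrow>
     (\<forall>c\<in>C. 0 < \<theta>C c) \<and> (\<Sum>c\<in>C. \<theta>C c) = 1 \<and>
     (\<forall>i\<in>{1..m}. \<forall>c\<in>C. (\<forall>y\<in>F i. 0 < \<theta>F (i, y, c)) \<and> (\<Sum>y\<in>F i. \<theta>F (i, y, c)) = 1)"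

text \<open>\<open>embed_pmf\<close> is only meaningful for a normalised density; see \<open>pmf_nb_dist\<close> below.\<close>

definition nb_dist ::
  "'c set \<Rightarrow> nat \<Rightarrow> (nat \<Rightarrow> 'y set) \<Rightarrow> ('c \<Rightarrow> real) \<Rightarrow> (nat \<times> 'y \<times> 'c \<Rightarrow> real)
    \<Rightarrow> ('c \<times> (nat \<Rightarrow> 'y)) pmf" where
  "nb_dist C m F \<theta>C \<theta>F = embed_pmf (\<lambda>(c, y).
     if (c, y) \<in> nb_space C m F then \<theta>C c * (\<Prod>i\<in>{1..m}. \<theta>F (i, y i, c)) else 0)"

definition nb_model :: "'c set \<Rightarrow> nat \<Rightarrow> (nat \<Rightarrow> 'y set) \<Rightarrow> ('c \<times> (nat \<Rightarrow> 'y)) pmf set" where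
  "nb_model C m F = {nb_dist C m F \<theta>C \<theta>F | \<theta>C \<theta>F. nb_params C m F \<theta>C \<theta>F}"

definition class_prob :: "('c \<times> (nat \<Rightarrow> 'y)) pmf \<Rightarrow> 'c \<Rightarrow> real" where
  "class_prob P c = \<P>(x in measure_pmf P. fst x = c)"

definition feat_prob :: "('c \<times> (nat \<Rightarrow> 'y)) pmf \<Rightarrow> nat \<times> 'y \<times> 'c \<Rightarrow> real" where
  "feat_prob P = (\<lambda>(i, y, c). \<P>(x in measure_pmf P. snd x i = y \<bar> fst x = c))"

definition prop_cov_param ::
  "(nat \<Rightarrow> 'y set) \<Rightarrow> (nat \<times> 'y \<times> 'c) set \<Rightarrow> (nat \<times> 'y \<times> 'c \<Rightarrow> real) \<Rightarrow> (nat \<times> 'y \<times> 'c \<Rightarrow> real)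
    \<Rightarrow> nat \<times> 'y \<times> 'c \<Rightarrow> real" where
  "prop_cov_param F V \<theta>V \<theta> = (\<lambda>(i, y, c).
     if V \<inter> block F i c = {} then \<theta> (i, y, c)
     else if (i, y, c) \<in> V then \<theta>V (i, y, c)
     else (1 - (\<Sum>j \<in> V \<inter> block F i c. \<theta>V j)) / (1 - (\<Sum>j \<in> V \<inter> block F i c. \<theta> j)) * \<theta> (i, y, c))"

definition prop_cov ::
  "'c set \<Rightarrow> nat \<Rightarrow> (nat \<Rightarrow> 'y set) \<Rightarrow> (nat \<times> 'y \<times> 'c) set \<Rightarrow> (nat \<times> 'y \<times> 'c \<Rightarrow> real)
    \<Rightarrow> ('c \<times> (nat \<Rightarrow> 'y)) pmf \<Rightarrow> ('c \<times> (nat \<Rightarrow> 'y)) pmf" where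
  "prop_cov C m F V \<theta>V P =
     nb_dist C m F (class_prob P) (prop_cov_param F V \<theta>V (feat_prob P))"

definition L_sensi ::
  "'c set \<Rightarrow> nat \<Rightarrow> (nat \<Rightarrow> 'y set) \<Rightarrow> (nat \<times> 'y \<times> 'c) set \<Rightarrow> (nat \<times> 'y \<times> 'c \<Rightarrow> real)
    \<Rightarrow> ('c \<times> (nat \<Rightarrow> 'y)) pmf \<Rightarrow> ('c \<times> (nat \<Rightarrow> 'y)) pmf set" where
  "L_sensi C m F V \<theta>V P = {Q \<in> nb_model C m F.
     (\<forall>c\<in>C. class_prob Q c = class_prob P c) \<and>
     (\<forall>i\<in>{1..m}. \<forall>c\<in>C. V \<inter> block F i c = {} \<longrightarrow>
        (\<forall>j \<in> block F i c. feat_prob Q j = feat_prob P j)) \<and>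
     (\<forall>j\<in>V. feat_prob Q j = \<theta>V j)}"

definition I_div :: "'a set \<Rightarrow> 'a pmf \<Rightarrow> 'a pmf \<Rightarrow> real" where
  "I_div Y Q P = (\<Sum>x\<in>Y. pmf Q x * ln (pmf Q x / pmf P x))"

definition is_I_projection :: "'a set \<Rightarrow> 'a pmf \<Rightarrow> 'a pmf set \<Rightarrow> 'a pmf \<Rightarrow> bool" where
  "is_I_projection Y P L P' \<longleftrightarrow> P' \<in> L \<and> (\<forall>Q\<in>L. I_div Y P' P \<le> I_div Y Q P)"

text \<open>The parameters of a member of the model are its class and conditional probabilities.\<close>

lemma sum_features:
  fixes m :: nat
  assumes "\<And>i. i \<in> {1..m} \<Longrightarrow> finite (F i)"
  shows "(\<Sum>y\<in>(\<Pi>\<^sub>E i\<in>{1..m}. F i). \<Prod>i\<in>{1..m}. \<theta>F (i, y i, c)) =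
         (\<Prod>i\<in>{1..m}. \<Sum>y\<in>F i. \<theta>F (i, y, c) :: real)"
  by (rule prod_sum_PiE[symmetric]) (use assms in auto)

lemma finite_nb_space:
  assumes "finite C" "\<And>i. i \<in> {1..m} \<Longrightarrow> finite (F i)"
  shows "finite (nb_space C m F)"
  using assms unfolding nb_space_def by (intro finite_cartesian_product finite_PiE) auto

lemma pmf_nb_dist:
  assumes "finite C" "\<And>i. i \<in> {1..m} \<Longrightarrow> finite (F i)" "nb_params C m F \<theta>C \<theta>F"
  shows "pmf (nb_dist C m F \<theta>C \<theta>F) (c, y) =
    (if (c, y) \<in> nb_space C m F then \<theta>C c * (\<Prod>i\<in>{1..m}. \<theta>F (i, y i, c)) else 0)"
proof -
  define f where "f = (\<lambda>(c, y). if (c, y) \<in> nb_space C m F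
    then \<theta>C c * (\<Prod>i\<in>{1..m}. \<theta>F (i, y i, c)) else (0::real))"
  have fin: "finite (nb_space C m F)" using assms(1,2) by (rule finite_nb_space)
  have nonneg: "0 \<le> f x" for x
    using assms(3) unfolding f_def nb_params_def nb_space_def
    by (auto split: prod.splits intro!: mult_pos_pos prod_pos less_imp_le simp: PiE_iff)
  have "(\<integral>\<^sup>+ x. ennreal (f x) \<partial>count_space UNIV) = (\<Sum>x\<in>nb_space C m F. ennreal (f x))"
    using fin by (intro nn_integral_count_space') (auto simp: f_def)
  also have "\<dots> = ennreal (\<Sum>x\<in>nb_space C m F. f x)"
    using nonneg by (simp add: sum_ennreal)
  also have "(\<Sum>x\<in>nb_space C m F. f x) =
      (\<Sum>x\<in>C \<times> (\<Pi>\<^sub>E i\<in>{1..m}. F i). case x of (c, y) \<Rightarrow> \<theta>C c * (\<Prod>i\<in>{1..m}. \<theta>F (i, y i, c)))"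
    unfolding nb_space_def by (intro sum.cong) (auto simp: f_def nb_space_def)
  also have "\<dots> = (\<Sum>c\<in>C. \<theta>C c * (\<Sum>y\<in>(\<Pi>\<^sub>E i\<in>{1..m}. F i). \<Prod>i\<in>{1..m}. \<theta>F (i, y i, c)))"
    by (simp add: sum.cartesian_product[symmetric] sum_distrib_left)
  also have "\<dots> = (\<Sum>c\<in>C. \<theta>C c * (\<Prod>i\<in>{1..m}. \<Sum>y\<in>F i. \<theta>F (i, y, c)))"
    using assms(2) by (simp only: sum_features)
  also have "\<dots> = (\<Sum>c\<in>C. \<theta>C c)"
    using assms(3) by (intro sum.cong) (auto simp: nb_params_def)
  also have "\<dots> = 1" using assms(3) by (simp add: nb_params_def)
  finally have "(\<integral>\<^sup>+ x. ennreal (f x) \<partial>count_space UNIV) = 1" by simp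
  then have "pmf (embed_pmf f) (c, y) = f (c, y)"
    using nonneg by (intro pmf_embed_pmf) auto
  then show ?thesis unfolding nb_dist_def f_def by simp
qed

lemma prob_nb_dist:
  assumes "finite C" "\<And>i. i \<in> {1..m} \<Longrightarrow> finite (F i)" "nb_params C m F \<theta>C \<theta>F"
    and "c \<in> C" "\<And>i. i \<in> {1..m} \<Longrightarrow> G i \<subseteq> F i"
  shows "measure_pmf.prob (nb_dist C m F \<theta>C \<theta>F) ({c} \<times> (\<Pi>\<^sub>E i\<in>{1..m}. G i)) =
    \<theta>C c * (\<Prod>i\<in>{1..m}. \<Sum>y\<in>G i. \<theta>F (i, y, c))"
proof -
  have finG: "finite (G i)" if "i \<in> {1..m}" for i
    using assms(2,5) that finite_subset by blast
  have "finite (\<Pi>\<^sub>E i\<in>{1..m}. G i)" using finG by (intro finite_PiE) auto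
  then have "measure_pmf.prob (nb_dist C m F \<theta>C \<theta>F) ({c} \<times> (\<Pi>\<^sub>E i\<in>{1..m}. G i)) =
    (\<Sum>x\<in>{c} \<times> (\<Pi>\<^sub>E i\<in>{1..m}. G i). pmf (nb_dist C m F \<theta>C \<theta>F) x)"
    by (intro measure_measure_pmf_finite) auto
  also have "\<dots> = (\<Sum>y\<in>(\<Pi>\<^sub>E i\<in>{1..m}. G i). pmf (nb_dist C m F \<theta>C \<theta>F) (c, y))"
    by (simp add: sum.cartesian_product')
  also have "\<dots> = (\<Sum>y\<in>(\<Pi>\<^sub>E i\<in>{1..m}. G i). \<theta>C c * (\<Prod>i\<in>{1..m}. \<theta>F (i, y i, c)))"
  proof (intro sum.cong refl)
    fix y assume "y \<in> (\<Pi>\<^sub>E i\<in>{1..m}. G i)"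
    then have "(c, y) \<in> nb_space C m F"
      using assms(4,5) unfolding nb_space_def by (auto simp: PiE_iff subset_eq)
    then show "pmf (nb_dist C m F \<theta>C \<theta>F) (c, y) = \<theta>C c * (\<Prod>i\<in>{1..m}. \<theta>F (i, y i, c))"
      using pmf_nb_dist[OF assms(1-3)] by simp
  qed
  also have "\<dots> = \<theta>C c * (\<Prod>i\<in>{1..m}. \<Sum>y\<in>G i. \<theta>F (i, y, c))"
    using finG by (simp only: sum_distrib_left[symmetric] sum_features)
  finally show ?thesis .
qed

lemma set_pmf_nb_dist:
  assumes "finite C" "\<And>i. i \<in> {1..m} \<Longrightarrow> finite (F i)" "nb_params C m F \<theta>C \<theta>F"
  shows "set_pmf (nb_dist C m F \<theta>C \<theta>F) \<subseteq> nb_space C m F"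
proof
  fix x assume "x \<in> set_pmf (nb_dist C m F \<theta>C \<theta>F)"
  then show "x \<in> nb_space C m F"
    using pmf_nb_dist[OF assms, of "fst x" "snd x"] by (auto simp: set_pmf_iff split: if_splits)
qed

lemma class_prob_nb_dist:
  assumes "finite C" "\<And>i. i \<in> {1..m} \<Longrightarrow> finite (F i)" "nb_params C m F \<theta>C \<theta>F" "c \<in> C"
  shows "class_prob (nb_dist C m F \<theta>C \<theta>F) c = \<theta>C c"
proof -
  have "class_prob (nb_dist C m F \<theta>C \<theta>F) c =
    measure_pmf.prob (nb_dist C m F \<theta>C \<theta>F) ({c} \<times> (\<Pi>\<^sub>E i\<in>{1..m}. F i))"
    unfolding class_prob_def using set_pmf_nb_dist[OF assms(1-3)]
    by (intro measure_pmf.finite_measure_eq_AE) (auto simp: AE_measure_pmf_iff nb_space_def)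
  also have "\<dots> = \<theta>C c * (\<Prod>i\<in>{1..m}. \<Sum>y\<in>F i. \<theta>F (i, y, c))"
    using assms by (intro prob_nb_dist) auto
  also have "\<dots> = \<theta>C c" using assms(3,4) by (simp add: nb_params_def)
  finally show ?thesis .
qed

lemma feat_prob_nb_dist:
  assumes "finite C" "\<And>i. i \<in> {1..m} \<Longrightarrow> finite (F i)" "nb_params C m F \<theta>C \<theta>F"
    and "c \<in> C" "i \<in> {1..m}" "v \<in> F i"
  shows "feat_prob (nb_dist C m F \<theta>C \<theta>F) (i, v, c) = \<theta>F (i, v, c)"
proof -
  let ?D = "nb_dist C m F \<theta>C \<theta>F"
  have G: "(F(i := {v})) j \<subseteq> F j" for j using assms(6) by auto
  have "\<P>(x in measure_pmf ?D. snd x i = v \<and> fst x = c) =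
    measure_pmf.prob ?D ({c} \<times> (\<Pi>\<^sub>E j\<in>{1..m}. (F(i := {v})) j))"
  proof (intro measure_pmf.finite_measure_eq_AE AE_pmfI)
    fix x assume "x \<in> set_pmf ?D"
    then have "x \<in> nb_space C m F" using set_pmf_nb_dist[OF assms(1-3)] by auto
    then show "x \<in> {x \<in> space (measure_pmf ?D). snd x i = v \<and> fst x = c} \<longleftrightarrow>
      x \<in> {c} \<times> (\<Pi>\<^sub>E j\<in>{1..m}. (F(i := {v})) j)"
      using assms(5) by (cases x) (auto simp: nb_space_def PiE_iff split: if_splits)
  qed auto
  also have "\<dots> = \<theta>C c * (\<Prod>j\<in>{1..m}. \<Sum>y\<in>(F(i := {v})) j. \<theta>F (j, y, c))"
    using assms(1-4) G by (intro prob_nb_dist)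
  also have "(\<Prod>j\<in>{1..m}. \<Sum>y\<in>(F(i := {v})) j. \<theta>F (j, y, c)) =
      (\<Prod>j\<in>{1..m}. if j = i then \<theta>F (i, v, c) else 1)"
    using assms(3,4) by (intro prod.cong) (auto simp: nb_params_def)
  also have "\<dots> = \<theta>F (i, v, c)" using assms(5) by (subst prod.delta) auto
  finally have "\<P>(x in measure_pmf ?D. snd x i = v \<and> fst x = c) = \<theta>C c * \<theta>F (i, v, c)" .
  moreover have "\<P>(x in measure_pmf ?D. fst x = c) = \<theta>C c"
    using class_prob_nb_dist[OF assms(1-4)] by (simp add: class_prob_def)
  moreover have "0 < \<theta>C c" using assms(3,4) by (simp add: nb_params_def)
  ultimately show ?thesis by (simp add: feat_prob_def cond_prob_def)
qed

end

theory Submission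
  imports Defs
begin

text \<open>
  By the chain rule, the divergence between two members of the model is the divergence of the
  class distributions plus the class-weighted divergences of the blocks, so it can be minimised
  block by block. In a block with fixed entries, let \<open>p\<close>, \<open>t\<close>, \<open>q\<close> be the original, the
  proportionally covaried and an arbitrary admissible conditional distribution. Since \<open>ln (t / p)\<close>
  is constant off the fixed entries, its means under \<open>q\<close> and \<open>t\<close> agree, which gives the
  Pythagorean identity \<open>D(q, p) = D(q, t) + D(t, p)\<close>; Gibbs' inequality concludes.
\<close>

section \<open>Divergence within a single block\<close>

text \<open>Termwise, this is \<open>ln z \<le> z - 1\<close> at \<open>z = t x / q x\<close>,
  multiplied by \<open>q x\<close>. In the application \<open>q\<close> and \<open>t\<close> have
  equal totals, so the left-hand side vanishes.\<close>

lemma gibbs_inequality: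
  fixes q t :: "'a \<Rightarrow> real"
  assumes "\<And>x. x \<in> S \<Longrightarrow> 0 < q x" "\<And>x. x \<in> S \<Longrightarrow> 0 < t x"
  shows "sum q S - sum t S \<le> (\<Sum>x\<in>S. q x * ln (q x / t x))"
proof -
  have "q x - t x \<le> q x * ln (q x / t x)" if "x \<in> S" for x
  proof -
    have pos: "0 < q x" "0 < t x" using assms that by auto
    then have "ln (t x / q x) \<le> t x / q x - 1" by (intro ln_le_minus_one) simp
    then have "q x * ln (t x / q x) \<le> q x * (t x / q x - 1)"
      using pos by (intro mult_left_mono) auto
    then show ?thesis using pos by (simp add: ln_div algebra_simps)
  qed
  then show ?thesis by (simp add: sum_subtractf[symmetric] sum_mono)
qed

text \<open>Here \<open>S\<close> is the set of feature values of one block, \<open>T\<close> marks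
  the prescribed entries, and \<open>k\<close> is the common factor that rescales the original
  entries off \<open>T\<close>.\<close>

lemma proportional_covariation_minimises:
  fixes p q t :: "'a \<Rightarrow> real"
  assumes p: "\<And>x. x \<in> S \<Longrightarrow> 0 < p x"
    and q: "\<And>x. x \<in> S \<Longrightarrow> 0 < q x"
    and t: "\<And>x. x \<in> S \<Longrightarrow> 0 < t x"
    and sum_eq: "sum q S = sum t S"
    and fixed: "\<And>x. x \<in> S \<inter> T \<Longrightarrow> q x = t x"
    and scaled: "\<And>x. x \<in> S - T \<Longrightarrow> t x = k * p x"
  shows "(\<Sum>x\<in>S. t x * ln (t x / p x)) \<le> (\<Sum>x\<in>S. q x * ln (q x / p x))"
proof -
  \<comment> \<open>On \<open>T\<close> both sides vanish because \<open>q x = t x\<close>; off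
    \<open>T\<close> the ratio \<open>t x / p x\<close> equals \<open>k\<close>.\<close>
  have "(q x - t x) * ln (t x / p x) = (q x - t x) * ln k" if "x \<in> S" for x
    using that fixed scaled p[OF that] by (cases "x \<in> T") auto
  then have "(\<Sum>x\<in>S. (q x - t x) * ln (t x / p x)) = (\<Sum>x\<in>S. q x - t x) * ln k"
    by (simp only: sum_distrib_right cong: sum.cong)
  \<comment> \<open>The constant \<open>ln k\<close> is multiplied by the difference of the totals
    of \<open>q\<close> and \<open>t\<close>, which is 0.\<close>
  then have mean: "(\<Sum>x\<in>S. q x * ln (t x / p x)) = (\<Sum>x\<in>S. t x * ln (t x / p x))"
    using sum_eq by (simp add: sum_subtractf left_diff_distrib)
  have "q x * ln (q x / p x) = q x * ln (q x / t x) + q x * ln (t x / p x)" if "x \<in> S" for x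
    using p[OF that] q[OF that] t[OF that] by (simp add: ln_div algebra_simps)
  then have "(\<Sum>x\<in>S. q x * ln (q x / p x)) =
      (\<Sum>x\<in>S. q x * ln (q x / t x)) + (\<Sum>x\<in>S. t x * ln (t x / p x))"
    by (simp add: sum.distrib mean)
  moreover have "0 \<le> (\<Sum>x\<in>S. q x * ln (q x / t x))"
    using gibbs_inequality[of S q t] q t sum_eq by simp
  ultimately show ?thesis by linarith
qed

section \<open>Chain rule for the divergence of two members of the model\<close>

text \<open>A function of one coordinate has the same mean under product weights as under its
  marginal. Absorbing \<open>g\<close> into factor \<open>i\<close> gives the factors
  \<open>r\<close>; the sum of products then becomes a product of sums, in which every factor except
  the one at \<open>i\<close> is 1.\<close>

lemma sum_PiE_prod_marginal:
  fixes p :: "'i \<Rightarrow> 'a \<Rightarrow> 'b::comm_semiring_1"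
  assumes fin: "finite I" "\<And>j. j \<in> I \<Longrightarrow> finite (F j)"
    and norm: "\<And>j. j \<in> I \<Longrightarrow> sum (p j) (F j) = 1"
    and i: "i \<in> I"
  shows "(\<Sum>y\<in>Pi\<^sub>E I F. (\<Prod>j\<in>I. p j (y j)) * g (y i)) = (\<Sum>v\<in>F i. p i v * g v)"
proof -
  define r where "r j v = (if j = i then p j v * g v else p j v)" for j v
  have "(\<Prod>j\<in>I. p j (y j)) * g (y i) = (\<Prod>j\<in>I. r j (y j))" for y
    using fin(1) i by (simp add: r_def prod.remove[of I i] mult_ac)
  then have "(\<Sum>y\<in>Pi\<^sub>E I F. (\<Prod>j\<in>I. p j (y j)) * g (y i)) = (\<Prod>j\<in>I. \<Sum>v\<in>F j. r j v)"
    using fin by (simp add: prod_sum_PiE)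
  also have "\<dots> = (\<Prod>j\<in>I. if j = i then \<Sum>v\<in>F i. p i v * g v else 1)"
    using norm by (intro prod.cong) (auto simp: r_def)
  also have "\<dots> = (\<Sum>v\<in>F i. p i v * g v)"
    using fin(1) i by simp
  finally show ?thesis .
qed

text \<open>The logarithm of the ratio of the two densities is a class term plus one term per
  feature. Given the class, the term of feature \<open>i\<close> depends on \<open>y i\<close>
  alone, so its mean reduces to a sum over \<open>F i\<close>.\<close>

lemma I_div_nb_dist:
  fixes m :: nat
  assumes C: "finite C" and F: "\<And>i. i \<in> {1..m} \<Longrightarrow> finite (F i)"
    and \<eta>: "nb_params C m F \<eta>C \<eta>F" and \<theta>: "nb_params C m F \<theta>C \<theta>F"
  shows "I_div (nb_space C m F) (nb_dist C m F \<eta>C \<eta>F) (nb_dist C m F \<theta>C \<theta>F) =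
    (\<Sum>c\<in>C. \<eta>C c * (ln (\<eta>C c / \<theta>C c) +
      (\<Sum>i\<in>{1..m}. \<Sum>v\<in>F i. \<eta>F (i, v, c) * ln (\<eta>F (i, v, c) / \<theta>F (i, v, c)))))"
proof -
  let ?Y = "\<Pi>\<^sub>E i\<in>{1..m}. F i"
  let ?w = "\<lambda>c y. \<Prod>i\<in>{1..m}. \<eta>F (i, y i, c)"
  let ?l = "\<lambda>c i v. ln (\<eta>F (i, v, c) / \<theta>F (i, v, c))"
  have term_eq: "pmf (nb_dist C m F \<eta>C \<eta>F) (c, y) *
      ln (pmf (nb_dist C m F \<eta>C \<eta>F) (c, y) / pmf (nb_dist C m F \<theta>C \<theta>F) (c, y)) =
      \<eta>C c * (?w c y * ln (\<eta>C c / \<theta>C c) + (\<Sum>i\<in>{1..m}. ?w c y * ?l c i (y i)))"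
    if c: "c \<in> C" and y: "y \<in> ?Y" for c y
  proof -
    have mem: "(c, y) \<in> nb_space C m F" using c y by (simp add: nb_space_def)
    have pos: "0 < \<eta>C c" "0 < \<theta>C c"
      "\<And>i. i \<in> {1..m} \<Longrightarrow> 0 < \<eta>F (i, y i, c)" "\<And>i. i \<in> {1..m} \<Longrightarrow> 0 < \<theta>F (i, y i, c)"
      using \<eta> \<theta> c y unfolding nb_params_def by (auto simp: PiE_iff)
    have "\<eta>C c * ?w c y / (\<theta>C c * (\<Prod>i\<in>{1..m}. \<theta>F (i, y i, c))) =
        \<eta>C c / \<theta>C c * (\<Prod>i\<in>{1..m}. \<eta>F (i, y i, c) / \<theta>F (i, y i, c))"
      by (simp add: prod_dividef)
    also have "ln \<dots> = ln (\<eta>C c / \<theta>C c) + ln (\<Prod>i\<in>{1..m}. \<eta>F (i, y i, c) / \<theta>F (i, y i, c))"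
      using pos by (intro ln_mult_pos divide_pos_pos prod_pos ballI)
    also have "ln (\<Prod>i\<in>{1..m}. \<eta>F (i, y i, c) / \<theta>F (i, y i, c)) = (\<Sum>i\<in>{1..m}. ?l c i (y i))"
      using pos by (intro ln_prod finite_atLeastAtMost divide_pos_pos[THEN less_imp_neq, THEN not_sym])
    finally have "ln (\<eta>C c * ?w c y / (\<theta>C c * (\<Prod>i\<in>{1..m}. \<theta>F (i, y i, c)))) =
        ln (\<eta>C c / \<theta>C c) + (\<Sum>i\<in>{1..m}. ?l c i (y i))" .
    moreover have "pmf (nb_dist C m F \<eta>C \<eta>F) (c, y) = \<eta>C c * ?w c y"
      using pmf_nb_dist[OF C F \<eta>] mem by presburger
    moreover have "pmf (nb_dist C m F \<theta>C \<theta>F) (c, y) = \<theta>C c * (\<Prod>i\<in>{1..m}. \<theta>F (i, y i, c))"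
      using pmf_nb_dist[OF C F \<theta>] mem by presburger
    ultimately show ?thesis
      by (simp add: distrib_left sum_distrib_left mult_ac)
  qed
  have norm: "(\<Sum>v\<in>F i. \<eta>F (i, v, c)) = 1" if "i \<in> {1..m}" "c \<in> C" for i c
    using \<eta> that by (simp add: nb_params_def)
  \<comment> \<open>Given the class, the feature weights have total mass 1, so averaging leaves the
    class term unchanged.\<close>
  have w_sum: "(\<Sum>y\<in>?Y. ?w c y) = 1" if "c \<in> C" for c
    using norm that F by (simp only: sum_features) simp
  have "I_div (nb_space C m F) (nb_dist C m F \<eta>C \<eta>F) (nb_dist C m F \<theta>C \<theta>F) =
      (\<Sum>c\<in>C. \<Sum>y\<in>?Y. pmf (nb_dist C m F \<eta>C \<eta>F) (c, y) *
        ln (pmf (nb_dist C m F \<eta>C \<eta>F) (c, y) / pmf (nb_dist C m F \<theta>C \<theta>F) (c, y)))"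
    unfolding I_div_def nb_space_def by (simp add: sum.cartesian_product')
  also have "\<dots> = (\<Sum>c\<in>C. \<Sum>y\<in>?Y.
      \<eta>C c * (?w c y * ln (\<eta>C c / \<theta>C c) + (\<Sum>i\<in>{1..m}. ?w c y * ?l c i (y i))))"
    by (intro sum.cong refl term_eq)
  \<comment> \<open>Exchanging the sums over features and over \<open>?Y\<close> leaves inner sums
    whose logarithm involves a single coordinate, ready for marginalisation.\<close>
  also have "\<dots> = (\<Sum>c\<in>C. \<eta>C c * ((\<Sum>y\<in>?Y. ?w c y) * ln (\<eta>C c / \<theta>C c) +
      (\<Sum>i\<in>{1..m}. \<Sum>y\<in>?Y. ?w c y * ?l c i (y i))))"
    by (subst sum.swap[of _ ?Y "{1..m}"])
      (simp add: sum_distrib_left[symmetric] sum_distrib_right sum.distrib)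
  also have "\<dots> = (\<Sum>c\<in>C. \<eta>C c * (ln (\<eta>C c / \<theta>C c) +
      (\<Sum>i\<in>{1..m}. \<Sum>v\<in>F i. \<eta>F (i, v, c) * ?l c i v)))"
  proof (intro sum.cong refl arg_cong2[where f = "(*)"] arg_cong2[where f = "(+)"])
    fix c i assume "c \<in> C" "i \<in> {1..m}"
    then show "(\<Sum>y\<in>?Y. ?w c y * ?l c i (y i)) = (\<Sum>v\<in>F i. \<eta>F (i, v, c) * ?l c i v)"
      using norm F
      by (intro sum_PiE_prod_marginal[where p = "\<lambda>i v. \<eta>F (i, v, c)" and g = "?l c i"]) auto
  qed (simp only: w_sum mult_1)
  finally show ?thesis .
qed

section \<open>Canonical parameters, and validity of the covaried parameters\<close>

text \<open>Any parameters generating \<open>Q\<close> agree with its class and conditional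
  probabilities on the index sets. The existential witnesses in \<open>nb_model\<close> can
  therefore be replaced by the quantities in which \<open>prop_cov\<close> and
  \<open>L_sensi\<close> are expressed.\<close>

lemma
  assumes C: "finite C" and F: "\<And>i. i \<in> {1..m} \<Longrightarrow> finite (F i)" and Q: "Q \<in> nb_model C m F"
  shows nb_params_canonical: "nb_params C m F (class_prob Q) (feat_prob Q)"
    and nb_dist_canonical: "nb_dist C m F (class_prob Q) (feat_prob Q) = Q"
proof -
  obtain \<theta>C \<theta>F where Q_eq: "Q = nb_dist C m F \<theta>C \<theta>F" and \<theta>: "nb_params C m F \<theta>C \<theta>F"
    using Q by (auto simp: nb_model_def)
  have cl: "class_prob Q c = \<theta>C c" if "c \<in> C" for c
    unfolding Q_eq by (rule class_prob_nb_dist[OF C F \<theta> that])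
  have ft: "feat_prob Q (i, v, c) = \<theta>F (i, v, c)" if "c \<in> C" "i \<in> {1..m}" "v \<in> F i" for i v c
    unfolding Q_eq by (rule feat_prob_nb_dist[OF C F \<theta> that])
  show "nb_params C m F (class_prob Q) (feat_prob Q)"
    using \<theta> unfolding nb_params_def by (simp add: cl ft cong: sum.cong)
  \<comment> \<open>The two parameter functions may differ at other indices, but the density reads
    them only on \<open>nb_space\<close> and is 0 elsewhere.\<close>
  have "(\<lambda>(c, y). if (c, y) \<in> nb_space C m F
        then class_prob Q c * (\<Prod>i\<in>{1..m}. feat_prob Q (i, y i, c)) else 0) =
      (\<lambda>(c, y). if (c, y) \<in> nb_space C m F
        then \<theta>C c * (\<Prod>i\<in>{1..m}. \<theta>F (i, y i, c)) else 0)"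
    by (intro ext) (auto simp: nb_space_def PiE_iff cl ft intro!: prod.cong)
  then have "nb_dist C m F (class_prob Q) (feat_prob Q) = nb_dist C m F \<theta>C \<theta>F"
    unfolding nb_dist_def by (rule arg_cong)
  then show "nb_dist C m F (class_prob Q) (feat_prob Q) = Q" by (simp only: Q_eq[symmetric])
qed

lemma sum_Int_block:
  "sum f (V \<inter> block F i c) = (\<Sum>y\<in>{y \<in> F i. (i, y, c) \<in> V}. f (i, y, c))"
proof -
  have "V \<inter> block F i c = (\<lambda>y. (i, y, c)) ` {y \<in> F i. (i, y, c) \<in> V}"
    by (auto simp: block_def)
  then show ?thesis by (simp add: sum.reindex inj_on_def)
qed

text \<open>Let \<open>a\<close> and \<open>b\<close> be the old and new mass of the varied entries.
  The other entries have mass \<open>1 - a\<close>, which rescaling turns into \<open>1 - b\<close>,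
  so the block still sums to 1.\<close>

lemma prop_cov_param_block:
  assumes fin: "finite (F i)"
    and pos: "\<And>y. y \<in> F i \<Longrightarrow> 0 < \<theta> (i, y, c)"
    and norm: "(\<Sum>y\<in>F i. \<theta> (i, y, c)) = 1"
    and proper: "V \<inter> block F i c \<subset> block F i c"
    and posV: "\<And>j. j \<in> V \<Longrightarrow> 0 < \<theta>V j"
    and less1: "V \<inter> block F i c \<noteq> {} \<Longrightarrow> (\<Sum>j \<in> V \<inter> block F i c. \<theta>V j) < 1"
  shows prop_cov_param_pos: "y \<in> F i \<Longrightarrow> 0 < prop_cov_param F V \<theta>V \<theta> (i, y, c)"
    and sum_prop_cov_param: "(\<Sum>y\<in>F i. prop_cov_param F V \<theta>V \<theta> (i, y, c)) = 1"
proof -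
  let ?t = "\<lambda>y. prop_cov_param F V \<theta>V \<theta> (i, y, c)"
  define A where "A = {y \<in> F i. (i, y, c) \<in> V}"
  define a where "a = (\<Sum>y\<in>A. \<theta> (i, y, c))"
  define b where "b = (\<Sum>y\<in>A. \<theta>V (i, y, c))"
  have "(y \<in> F i \<longrightarrow> 0 < ?t y) \<and> sum ?t (F i) = 1" for y
  proof (cases "V \<inter> block F i c = {}")
    case True
    then show ?thesis using pos norm by (simp add: prop_cov_param_def)
  next
    case False
    \<comment> \<open>Properness leaves an entry outside \<open>A\<close>; its positive probability
      forces \<open>a < 1\<close>, so the scaling factor has a positive denominator.\<close>
    have A: "A \<subseteq> F i" "F i - A \<noteq> {}" using proper by (auto simp: A_def block_def)
    have rest: "(\<Sum>y\<in>F i - A. \<theta> (i, y, c)) = 1 - a"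
      using sum.subset_diff[OF A(1) fin, of "\<lambda>y. \<theta> (i, y, c)"] norm by (simp add: a_def)
    moreover have "0 < (\<Sum>y\<in>F i - A. \<theta> (i, y, c))"
      using A fin pos by (intro sum_pos) auto
    ultimately have a: "a < 1" by simp
    have b: "b < 1" using less1[OF False] by (simp add: sum_Int_block A_def b_def)
    have t: "?t y = (if y \<in> A then \<theta>V (i, y, c) else (1 - b) / (1 - a) * \<theta> (i, y, c))"
      if "y \<in> F i" for y
      using False that by (simp add: prop_cov_param_def sum_Int_block A_def a_def b_def)
    have "sum ?t (F i) = sum ?t (F i - A) + sum ?t A" by (rule sum.subset_diff[OF A(1) fin])
    also have "sum ?t A = b" using A(1) by (auto simp: b_def t intro!: sum.cong)
    also have "sum ?t (F i - A) = (1 - b) / (1 - a) * (\<Sum>y\<in>F i - A. \<theta> (i, y, c))"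
      by (simp add: t sum_distrib_left)
    finally have "sum ?t (F i) = 1" using a by (simp add: rest)
    then show ?thesis using a b pos posV by (auto simp: t A_def)
  qed
  then show "y \<in> F i \<Longrightarrow> 0 < ?t y" and "sum ?t (F i) = 1" by auto
qed

section \<open>Membership of the covariation in \<open>L_sensi\<close> and minimality of its
  divergence\<close>

theorem theorem5:
  fixes C :: "'c set" and m :: nat and F :: "nat \<Rightarrow> 'y set"
    and P :: "('c \<times> (nat \<Rightarrow> 'y)) pmf"
    and V :: "(nat \<times> 'y \<times> 'c) set" and \<theta>V :: "nat \<times> 'y \<times> 'c \<Rightarrow> real"
  assumes "finite C"
    and "\<And>i. i \<in> {1..m} \<Longrightarrow> finite (F i)"
    and "P \<in> nb_model C m F"
    and "V \<noteq> {}"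
    and "V \<subseteq> (\<Union>i\<in>{1..m}. \<Union>c\<in>C. block F i c)"
    and "\<And>i c. i \<in> {1..m} \<Longrightarrow> c \<in> C \<Longrightarrow> V \<inter> block F i c \<subset> block F i c"
    and "\<And>j. j \<in> V \<Longrightarrow> 0 < \<theta>V j"
    and "\<And>i c. i \<in> {1..m} \<Longrightarrow> c \<in> C \<Longrightarrow> V \<inter> block F i c \<noteq> {} \<Longrightarrow>
           (\<Sum>j \<in> V \<inter> block F i c. \<theta>V j) \<in> {0<..<1}"
  shows "is_I_projection (nb_space C m F) P (L_sensi C m F V \<theta>V P) (prop_cov C m F V \<theta>V P)"
proof -
  note C = assms(1) and F = assms(2) and V = assms(5) and posV = assms(7)
  let ?\<theta> = "feat_prob P" and ?t = "prop_cov_param F V \<theta>V (feat_prob P)"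
  have P: "nb_params C m F (class_prob P) ?\<theta>" "nb_dist C m F (class_prob P) ?\<theta> = P"
    by (rule nb_params_canonical[OF C F assms(3)], assumption)
      (rule nb_dist_canonical[OF C F assms(3)])
  \<comment> \<open>Used to cancel the ratio of equal class probabilities to 1, which removes the
    class term from the chain rule.\<close>
  have class_nonzero: "class_prob P c \<noteq> 0" if "c \<in> C" for c
    using P(1) that by (auto simp: nb_params_def)
  have t: "(\<forall>y\<in>F i. 0 < ?t (i, y, c)) \<and> (\<Sum>y\<in>F i. ?t (i, y, c)) = 1"
    if i: "i \<in> {1..m}" and c: "c \<in> C" for i c
  proof -
    have \<theta>: "\<And>y. y \<in> F i \<Longrightarrow> 0 < ?\<theta> (i, y, c)" "(\<Sum>y\<in>F i. ?\<theta> (i, y, c)) = 1"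
      using P(1) i c by (auto simp: nb_params_def)
    have less1: "(\<Sum>j \<in> V \<inter> block F i c. \<theta>V j) < 1" if "V \<inter> block F i c \<noteq> {}"
      using assms(8)[OF i c that] by simp
    show ?thesis
      using prop_cov_param_block[OF F[OF i] \<theta> assms(6)[OF i c] posV less1] by blast
  qed
  have T: "nb_params C m F (class_prob P) ?t"
    using P(1) t by (simp add: nb_params_def)
  have V_elim: "\<exists>i\<in>{1..m}. \<exists>c\<in>C. \<exists>y\<in>F i. j = (i, y, c)" if "j \<in> V" for j
    using V that by (force simp: block_def)
  have t_V: "?t j = \<theta>V j" if "j \<in> V" for j
  proof -
    obtain i y c where j: "j = (i, y, c)" "y \<in> F i" using V_elim[OF \<open>j \<in> V\<close>] by auto
    then have "(i, y, c) \<in> V \<inter> block F i c" using that by (simp add: block_def)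
    then show ?thesis by (auto simp: prop_cov_param_def j(1))
  qed
  have feat_T: "feat_prob (prop_cov C m F V \<theta>V P) (i, y, c) = ?t (i, y, c)"
    if "i \<in> {1..m}" "c \<in> C" "y \<in> F i" for i y c
    unfolding prop_cov_def using that by (intro feat_prob_nb_dist C F T)
  have "prop_cov C m F V \<theta>V P \<in> L_sensi C m F V \<theta>V P"
    unfolding L_sensi_def
  proof (intro CollectI conjI ballI impI)
    show "prop_cov C m F V \<theta>V P \<in> nb_model C m F"
      using T by (auto simp: nb_model_def prop_cov_def)
    show "class_prob (prop_cov C m F V \<theta>V P) c = class_prob P c" if "c \<in> C" for c
      unfolding prop_cov_def using that by (intro class_prob_nb_dist C F T)
    show "feat_prob (prop_cov C m F V \<theta>V P) j = ?\<theta> j"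
      if "i \<in> {1..m}" "c \<in> C" "V \<inter> block F i c = {}" "j \<in> block F i c" for i c j
      using that by (auto simp: block_def feat_T) (simp add: prop_cov_param_def block_def)
    show "feat_prob (prop_cov C m F V \<theta>V P) j = \<theta>V j" if "j \<in> V" for j
      using V_elim[OF that] t_V[OF that] by (auto simp: feat_T)
  qed
  moreover have "I_div (nb_space C m F) (prop_cov C m F V \<theta>V P) P \<le> I_div (nb_space C m F) Q P"
    if Q_L: "Q \<in> L_sensi C m F V \<theta>V P" for Q
  proof -
    let ?q = "feat_prob Q"
    have Q_model: "Q \<in> nb_model C m F"
      and Q_class: "\<And>c. c \<in> C \<Longrightarrow> class_prob Q c = class_prob P c"
      and Q_unvaried: "\<And>i c j. i \<in> {1..m} \<Longrightarrow> c \<in> C \<Longrightarrow> V \<inter> block F i c = {} \<Longrightarrow>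
        j \<in> block F i c \<Longrightarrow> ?q j = ?\<theta> j"
      and Q_V: "\<And>j. j \<in> V \<Longrightarrow> ?q j = \<theta>V j"
      using Q_L unfolding L_sensi_def by blast+
    have Q: "nb_params C m F (class_prob Q) ?q" "nb_dist C m F (class_prob Q) ?q = Q"
      by (rule nb_params_canonical[OF C F Q_model], assumption)
        (rule nb_dist_canonical[OF C F Q_model])
    have block_le: "(\<Sum>v\<in>F i. ?t (i, v, c) * ln (?t (i, v, c) / ?\<theta> (i, v, c))) \<le>
        (\<Sum>v\<in>F i. ?q (i, v, c) * ln (?q (i, v, c) / ?\<theta> (i, v, c)))"
      if i: "i \<in> {1..m}" and c: "c \<in> C" for i c
    proof (cases "V \<inter> block F i c = {}")
      case True
      \<comment> \<open>In an unvaried block \<open>?q\<close> and \<open>?t\<close> both coincide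
        with the original parameters, so the two sides are equal.\<close>
      then have "?q (i, v, c) = ?t (i, v, c)" if "v \<in> F i" for v
        using Q_unvaried[OF i c True, of "(i, v, c)"] that
        by (simp add: prop_cov_param_def block_def)
      then show ?thesis by simp
    next
      case False
      \<comment> \<open>This is the factor by which \<open>prop_cov_param\<close> rescales the free
        entries of the block.\<close>
      let ?k = "(1 - (\<Sum>j \<in> V \<inter> block F i c. \<theta>V j)) / (1 - (\<Sum>j \<in> V \<inter> block F i c. ?\<theta> j))"
      show ?thesis
      proof (rule proportional_covariation_minimises
          [where T = "{v. (i, v, c) \<in> V}" and k = ?k])
        show "(\<Sum>v\<in>F i. ?q (i, v, c)) = (\<Sum>v\<in>F i. ?t (i, v, c))"
          using Q(1) t[OF i c] i c by (simp add: nb_params_def)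
        show "?t (i, v, c) = ?k * ?\<theta> (i, v, c)" if "v \<in> F i - {v. (i, v, c) \<in> V}" for v
          using False that by (simp add: prop_cov_param_def)
      qed (use P(1) Q(1) T i c Q_V t_V in \<open>auto simp: nb_params_def\<close>)
    qed
    have "I_div (nb_space C m F) (prop_cov C m F V \<theta>V P) P = (\<Sum>c\<in>C. class_prob P c *
        (\<Sum>i\<in>{1..m}. \<Sum>v\<in>F i. ?t (i, v, c) * ln (?t (i, v, c) / ?\<theta> (i, v, c))))"
      using I_div_nb_dist[OF C F T P(1)]
      by (simp add: prop_cov_def P(2) class_nonzero cong: sum.cong)
    \<comment> \<open>Both divergences weight their blocks by the same positive class probabilities,
      so the blockwise inequalities add up.\<close>
    also have "\<dots> \<le> (\<Sum>c\<in>C. class_prob P c *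
        (\<Sum>i\<in>{1..m}. \<Sum>v\<in>F i. ?q (i, v, c) * ln (?q (i, v, c) / ?\<theta> (i, v, c))))"
      using P(1) by (intro sum_mono mult_left_mono block_le) (auto simp: nb_params_def less_imp_le)
    also have "\<dots> = I_div (nb_space C m F) Q P"
      using I_div_nb_dist[OF C F Q(1) P(1)]
      by (simp add: P(2) Q(2) Q_class class_nonzero cong: sum.cong)
    finally show ?thesis .
  qed
  ultimately show ?thesis by (simp add: is_I_projection_def)
qed

end
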